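(* Let $A\in\mathbb{R}^{n\times n}$, let $r_0,\tilde r_0\in\mathbb{C}^n$, and let $C,\tilde C\in\mathbb{C}^{n\times k}$ be such that $\mathcal{D}_c=\tilde C^*C$ is a diagonal matrix with positive, real (diagonal) coefficients. Let $\eta,\tilde\eta$ be scalars and put $$v_1=\eta\,(I-C\mathcal{D}_c^{-1}\tilde C^* )r_0,\qquad \tilde v_1=\tilde\eta\,(I-\tilde C\mathcal{D}_c^{-1}C^* )\tilde r_0,$$ $$B=(I-C\mathcal{D}_c^{-1}\tilde C^* )A,\qquad \tilde B=(I-\tilde C\mathcal{D}_c^{-1}C^* )A^*.$$ Let $v_1,\dots,v_m$ and $\tilde v_1,\dots,\tilde v_m$ be generated by the full recurrences $$\beta_{i+1,i}v_{i+1} = Bv_i - \beta_{ii}v_i - \beta_{i-1,i}v_{i-1} - \cdots - \beta_{1i}v_1,$$ $$\tilde\beta_{i+1,i}\tilde v_{i+1} = \tilde B\tilde v_i - \tilde\beta_{ii}\tilde v_i - \tilde\beta_{i-1,i}\tilde v_{i-1} - \cdots - \tilde\beta_{1i}\tilde v_1,$$ for $i\in\{1,2,\dots,m-1\}$, where the scalars $\beta_{ij},\tilde\beta_{ij}$ are determined by the constraints $$\tilde V_i^* V_i = I \quad\text{and}\quad \|v_i\| = 1 ,\qquad i=1,\dots,m,$$ with $V_i=[v_1\ \cdots\ v_i]$ and $\tilde V_i=[\tilde v_1\ \cdots\ \tilde v_i]$. Then $\beta_{ij}=0$ and $\tilde\beta_{ij}=0$ for $j>i+1$, which leads to the short-term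 recurrences $$\beta_{i+1,i}v_{i+1} = Bv_i - \beta_{ii}v_i - \beta_{i-1,i}v_{i-1},$$ $$\tilde\beta_{i+1,i}\tilde v_{i+1} = \tilde B\tilde v_i - \tilde\beta_{ii}\tilde v_i - \tilde\beta_{i-1,i}\tilde v_{i-1},$$ for $i\in\{1,2,\dots,m-1\}$.
   Context: Here $*$ denotes conjugate transpose and $\|\cdot\|$ the Euclidean norm. The vectors $r_0$ and $\tilde r_0$ are the initial residuals of a primary linear system $Ax=b$ and a dual linear system $A^*\tilde x=\tilde b$; only their being given vectors is used in the statement. For a square matrix $K$ and a vector $v$, $\mathcal{K}^{i}(K,v)=\mathrm{span}\{v,Kv,\dots,K^{i-1}v\}$. The columns of $V_m$ and $\tilde V_m$ are bases of $\mathcal{K}^m(B,v_1)$ and $\mathcal{K}^m(\tilde B,\tilde v_1)$, respectively. Standing assumptions: for $i<m$, $\mathcal{K}^i(B,v_1)$ is not an invariant subspace of $B$ and $\mathcal{K}^i(\tilde B,\tilde v_1)$ is not an invariant subspace of $\tilde B$; and no breakdown occurs, i.e. $\tilde v_i^*v_i\neq 0$ for all $i$, so that vectors satisfying the recurrences and the constraints exist up to index $m$. The coefficients $\beta_{ij},\tilde\beta_{ij}$ are those appearing in the recurrences (second index $j\in\{1,\dots,m-1\}$, first index $i\in\{1,\dots,j+1\}$). For $i=1$ the terms involving $v_0$, $\tilde v_0$ are absent. *)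

theory Defs
  imports "HOL-Analysis.Analysis"
begin

definition ctranspose :: "complex^'n^'m \<Rightarrow> complex^'m^'n" where
  "ctranspose M = (\<chi> i j. cnj (M $ j $ i))"

text \<open>\<open>cdot x y\<close> is the scalar \<open>x\<^sup>* y\<close>: conjugate-linear in the \<^emph>\<open>first\<close> argument.\<close>

definition cdot :: "complex^'n \<Rightarrow> complex^'n \<Rightarrow> complex" where
  "cdot x y = (\<Sum>l\<in>UNIV. cnj (x $ l) * y $ l)"

definition positive_diagonal :: "complex^'k^'k \<Rightarrow> bool" where
  "positive_diagonal M \<longleftrightarrow>
     (\<forall>i j. i \<noteq> j \<longrightarrow> M $ i $ j = 0) \<and> (\<forall>i. M $ i $ i \<in> \<real> \<and> Re (M $ i $ i) > 0)"

text \<open>Krylov and invariant subspaces are complex subspaces of \<open>complex^'n\<close>, hence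
  \<open>vec.span\<close> and \<open>vec.subspace\<close>; the unqualified \<open>span\<close> and \<open>subspace\<close> are over the reals.\<close>

definition krylov :: "nat \<Rightarrow> complex^'n^'n \<Rightarrow> complex^'n \<Rightarrow> (complex^'n) set" where
  "krylov i K v = vec.span ((\<lambda>l. (((*v) K) ^^ l) v) ` {..<i})"

definition invariant_subspace :: "complex^'n^'n \<Rightarrow> (complex^'n) set \<Rightarrow> bool" where
  "invariant_subspace K S \<longleftrightarrow> vec.subspace S \<and> (\<forall>x\<in>S. K *v x \<in> S)"

end

theory Submission
  imports Defs
begin

text \<open>The oblique projectors \<open>P = I - C D\<^sup>-\<^sup>1 Ct\<^sup>*\<close> and \<open>Pt = I - Ct D\<^sup>-\<^sup>1 C\<^sup>*\<close> are adjoint to each other because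
  \<open>D\<close> is real diagonal. Since no Krylov space of index below \<open>m\<close> is invariant, no subdiagonal coefficient vanishes,
  so the recurrences keep every \<open>v i\<close> in the range of \<open>P\<close> and every \<open>vt i\<close> in the range of \<open>Pt\<close>. On these
  ranges \<open>B = P A\<close> and \<open>Bt = Pt A\<^sup>*\<close> are mutually adjoint. Hence \<open>\<beta> i j = cdot (vt i) (B *v v j) =
  cdot (Bt *v vt i) (v j)\<close>, and \<open>Bt *v vt i\<close> is a combination of \<open>vt 1, \<dots>, vt (i+1)\<close>, all
  orthogonal to \<open>v j\<close> if \<open>j > i + 1\<close>.\<close>

section \<open>The Hermitian pairing and adjoint matrices\<close>

lemma cdot_commute: "cdot y x = cnj (cdot x y)"
  by (simp add: cdot_def mult.commute)

lemma cdot_add_right: "cdot x (y + z) = cdot x y + cdot x z"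
  by (simp add: cdot_def distrib_left sum.distrib)

lemma cdot_scale_right: "cdot x (c *s y) = c * cdot x y"
  by (simp add: cdot_def sum_distrib_left mult_ac)

lemma cdot_sum_right: "cdot x (\<Sum>l\<in>S. f l) = (\<Sum>l\<in>S. cdot x (f l))"
  by (induction S rule: infinite_finite_induct) (simp_all add: cdot_add_right, simp_all add: cdot_def)

lemma cdot_matrix_vector_mult: "cdot x (M *v y) = cdot (ctranspose M *v x) y"
proof -
  have "cdot x (M *v y) = (\<Sum>i\<in>UNIV. \<Sum>j\<in>UNIV. cnj (x $ i) * (M $ i $ j * y $ j))"
    by (simp add: cdot_def matrix_vector_mult_def sum_distrib_left)
  also have "\<dots> = (\<Sum>j\<in>UNIV. \<Sum>i\<in>UNIV. cnj (x $ i) * (M $ i $ j * y $ j))"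
    by (rule sum.swap)
  also have "\<dots> = cdot (ctranspose M *v x) y"
    by (simp add: cdot_def ctranspose_def matrix_vector_mult_def sum_distrib_left sum_distrib_right mult_ac)
  finally show ?thesis .
qed

lemma ctranspose_ctranspose [simp]: "ctranspose (ctranspose M) = M"
  by (simp add: ctranspose_def vec_eq_iff)

lemma ctranspose_mult: "ctranspose (M ** N) = ctranspose N ** ctranspose M"
  by (simp add: ctranspose_def matrix_matrix_mult_def vec_eq_iff mult.commute)

lemma ctranspose_diff: "ctranspose (M - N) = ctranspose M - ctranspose N"
  by (simp add: ctranspose_def vec_eq_iff)

lemma ctranspose_mat_1: "ctranspose (mat 1) = mat 1"
  by (simp add: ctranspose_def mat_def vec_eq_iff)

section \<open>Positive diagonal matrices, their inverses, and oblique projectors\<close>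

lemma positive_diagonal_ctranspose:
  assumes "positive_diagonal D"
  shows "ctranspose D = D"
proof -
  have "cnj (D $ j $ i) = D $ i $ j" for i j
    using assms by (cases "i = j") (auto simp: positive_diagonal_def Reals_cnj_iff)
  then show ?thesis
    by (simp add: ctranspose_def vec_eq_iff)
qed

lemma positive_diagonal_matrix_inv:
  assumes "positive_diagonal D"
  shows "matrix_inv D ** D = mat 1" "D ** matrix_inv D = mat 1"
proof -
  define E where "E = (\<chi> i j. if i = j then inverse (D $ i $ i) else 0)"
  have nz: "D $ i $ i \<noteq> 0" for i
    using assms unfolding positive_diagonal_def by (metis less_irrefl zero_complex.sel(1))
  have D: "D $ i $ j = (if i = j then D $ i $ i else 0)" for i j
    using assms by (auto simp: positive_diagonal_def)
  \<comment> \<open>The condition \<open>l = i\<close> stands outermost so that the sum over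
    \<open>l\<close> in each matrix product collapses to a single term.\<close>
  have "D $ i $ l * E $ l $ j = (if l = i then if i = j then 1 else 0 else 0)"
    "E $ i $ l * D $ l $ j = (if l = i then if i = j then 1 else 0 else 0)" for i j l
    using nz[of i] D[of i l] D[of l j] by (auto simp: E_def)
  then have "D ** E = mat 1 \<and> E ** D = mat 1"
    by (simp add: vec_eq_iff matrix_matrix_mult_def mat_def)
  \<comment> \<open>\<open>matrix_inv\<close> is a choice among two-sided inverses, so the witness
    \<open>E\<close> of entrywise reciprocals is enough to give its properties.\<close>
  then have "D ** matrix_inv D = mat 1 \<and> matrix_inv D ** D = mat 1"
    unfolding matrix_inv_def by (rule someI)
  then show "matrix_inv D ** D = mat 1" "D ** matrix_inv D = mat 1"
    by auto
qed

text \<open>Transposing \<open>D ** matrix_inv D = mat 1\<close> makes the adjoint of the inverse a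
  left inverse of \<open>D\<close>, and a left inverse agrees with any right inverse.\<close>

lemma positive_diagonal_ctranspose_matrix_inv:
  assumes "positive_diagonal D"
  shows "ctranspose (matrix_inv D) = matrix_inv D"
proof -
  have "ctranspose (matrix_inv D) ** D = mat 1"
    using positive_diagonal_matrix_inv(2)[OF assms] positive_diagonal_ctranspose[OF assms]
    by (metis ctranspose_mult ctranspose_mat_1)
  then show ?thesis
    using positive_diagonal_matrix_inv(2)[OF assms]
    by (metis matrix_mul_assoc matrix_mul_lid matrix_mul_rid)
qed

text \<open>In the square of \<open>C ** E ** F\<close> the inner factor
  \<open>E ** (F ** C)\<close> cancels, so this matrix is idempotent, and hence so is its
  complement.\<close>

lemma oblique_projector_idem:
  fixes C :: "complex^'k^'n" and F :: "complex^'n^'k" and E :: "complex^'k^'k"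
  assumes "E ** (F ** C) = mat 1"
  shows "(mat 1 - C ** E ** F) ** (mat 1 - C ** E ** F) = mat 1 - C ** E ** F"
proof -
  have "(C ** E ** F) ** (C ** E ** F) = C ** (E ** (F ** C)) ** E ** F"
    by (simp add: matrix_mul_assoc)
  then have "(C ** E ** F) ** (C ** E ** F) = C ** E ** F"
    by (simp add: assms)
  then have "(C ** E ** F) *v ((C ** E ** F) *v x) = (C ** E ** F) *v x" for x
    by (simp only: matrix_vector_mul_assoc)
  then show ?thesis
    by (simp add: matrix_eq matrix_vector_mul_assoc[symmetric] matrix_vector_mult_diff_distrib
        matrix_vector_mult_diff_rdistrib)
qed

section \<open>Krylov spaces and the full recurrences\<close>

lemma krylov_mono: "i \<le> j \<Longrightarrow> krylov i K x \<subseteq> krylov j K x"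
  unfolding krylov_def by (intro vec.span_mono image_mono) auto

lemma krylov_mult:
  assumes "y \<in> krylov i K x"
  shows "K *v y \<in> krylov (Suc i) K x"
  using assms unfolding krylov_def
proof (induction rule: vec.span_induct_alt)
  case base
  then show ?case
    using vec.span_zero by simp
next
  case (step c z y)
  then obtain l where l: "l < i" "z = (((*v) K) ^^ l) x"
    by auto
  have "K *v z = (((*v) K) ^^ Suc l) x"
    using l by simp
  also have "\<dots> \<in> vec.span ((\<lambda>l. (((*v) K) ^^ l) x) ` {..<Suc i})"
    using l by (intro vec.span_base imageI) auto
  finally show ?case
    using step.IH by (simp add: matrix_vector_right_distrib vector_scalar_commute vec.span_add vec.span_scale)
qed

text \<open>A nonzero subdiagonal coefficient lets the recurrence be solved for the next vector, and
  \<open>K\<close> raises the Krylov index by one. The bound \<open>n\<close> is free so that the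
  result also applies to an initial segment of a longer recurrence.\<close>

lemma recurrence_in_krylov:
  fixes v :: "nat \<Rightarrow> complex^'n"
  assumes rec: "\<forall>i\<in>{1..n}. \<beta> (i+1) i *s v (i+1) = K *v v i - (\<Sum>l=1..i. \<beta> l i *s v l)"
    and nz: "\<forall>i\<in>{1..n}. \<beta> (i+1) i \<noteq> 0"
    and "i \<in> {1..n+1}"
  shows "v i \<in> krylov i K (v 1)"
  using assms(3)
proof (induction i rule: less_induct)
  case (less i)
  show ?case
  proof (cases "i = 1")
    case True
    have "v 1 \<in> (\<lambda>l. (((*v) K) ^^ l) (v 1)) ` {..<1}"
      by (auto simp: lessThan_Suc)
    then show ?thesis
      unfolding True krylov_def by (rule vec.span_base)
  next
    case False
    then obtain j where j: "i = j + 1" "j \<in> {1..n}"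
      using less.prems by (cases i) auto
    have sub: "vec.subspace (krylov i K (v 1))"
      by (simp add: krylov_def)
    have IH: "v l \<in> krylov i K (v 1)" if "l \<in> {1..j}" for l
      using less.IH[of l] that j krylov_mono[of l i K "v 1"] by auto
    have "K *v v j \<in> krylov i K (v 1)"
      using krylov_mult[of "v j" j] less.IH[of j] j by auto
    then have "\<beta> i j *s v i \<in> krylov i K (v 1)"
      using rec j IH sub
      by (auto intro!: vec.subspace_diff vec.subspace_sum vec.subspace_scale)
    then have "inverse (\<beta> i j) *s (\<beta> i j *s v i) \<in> krylov i K (v 1)"
      using sub by (rule vec.subspace_scale[rotated])
    then show ?thesis
      using nz j by (simp add: vector_smult_assoc)
  qed
qed

text \<open>If the coefficient vanished, the span of \<open>v 1, \<dots>, v i\<close> would be an invariant subspace, equal to the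
  \<open>i\<close>-th Krylov space.\<close>

lemma recurrence_subdiagonal_nonzero:
  fixes v :: "nat \<Rightarrow> complex^'n"
  assumes rec: "\<forall>i\<in>{1..n}. \<beta> (i+1) i *s v (i+1) = K *v v i - (\<Sum>l=1..i. \<beta> l i *s v l)"
    and not_inv: "\<forall>i\<in>{1..n}. \<not> invariant_subspace K (krylov i K (v 1))"
    and "i \<in> {1..n}"
  shows "\<beta> (i+1) i \<noteq> 0"
  using assms(3)
proof (induction i rule: less_induct)
  case (less i)
  define W where "W = vec.span (v ` {1..i})"
  have sub: "vec.subspace W"
    by (simp add: W_def)
  have vW: "v l \<in> W" if "l \<in> {1..i}" for l
    using that unfolding W_def by (intro vec.span_base) auto
  show ?case
  proof
    assume zero: "\<beta> (i+1) i = 0"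
    have "v l \<in> krylov i K (v 1)" if "l \<in> {1..i}" for l
    proof -
      have "v l \<in> krylov l K (v 1)"
        \<comment> \<open>At this point only the coefficients below index \<open>i\<close> are known
          to be nonzero, by induction; hence the bound \<open>i - 1\<close>.\<close>
        using that less rec by (intro recurrence_in_krylov[of "i - 1" \<beta>]) auto
      then show ?thesis
        using krylov_mono[of l i K "v 1"] that by auto
    qed
    then have W_krylov: "W \<subseteq> krylov i K (v 1)"
      unfolding W_def by (intro vec.span_minimal) (auto simp: krylov_def)
    have Kv: "K *v v l \<in> W" if l: "l \<in> {1..i}" for l
    proof -
      have "K *v v l = \<beta> (l+1) l *s v (l+1) + (\<Sum>k=1..l. \<beta> k l *s v k)"
        using rec l less.prems by auto
      \<comment> \<open>For \<open>l < i\<close> the vector \<open>v (l+1)\<close> is still among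
        the generators of \<open>W\<close>; for \<open>l = i\<close> it may lie outside, but its
        coefficient vanishes.\<close>
      moreover have "\<beta> (l+1) l *s v (l+1) \<in> W"
        using zero l vW[of "l+1"] vec.subspace_0[OF sub] vec.subspace_scale[OF sub]
        by (cases "l = i") auto
      moreover have "(\<Sum>k=1..l. \<beta> k l *s v k) \<in> W"
        using l by (intro vec.subspace_sum[OF sub] vec.subspace_scale[OF sub] vW) auto
      ultimately show ?thesis
        using vec.subspace_add[OF sub] by simp
    qed
    have W_inv: "K *v x \<in> W" if "x \<in> W" for x
      using that[unfolded W_def]
    proof (induction rule: vec.span_induct_alt)
      case base
      then show ?case
        using vec.subspace_0[OF sub] by simp
    next
      case (step c z y)
      then show ?case
        using Kv sub
        by (auto simp: matrix_vector_right_distrib vector_scalar_commute vec.subspace_add vec.subspace_scale)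
    qed
    have "(((*v) K) ^^ l) (v 1) \<in> W" for l
      by (induction l) (use less.prems vW W_inv in auto)
    then have "krylov i K (v 1) \<subseteq> W"
      unfolding krylov_def by (intro vec.span_minimal sub) auto
    then have "krylov i K (v 1) = W"
      using W_krylov by auto
    then have "invariant_subspace K (krylov i K (v 1))"
      using W_inv sub by (simp add: invariant_subspace_def)
    then show False
      using not_inv less.prems by auto
  qed
qed

text \<open>Membership in the range of a projector is expressed as being fixed by it. Since
  \<open>P ** K = K\<close>, every \<open>K *v v j\<close> is fixed, so by linearity the right side
  of the recurrence is fixed, and the nonzero coefficient can be cancelled.\<close>

lemma recurrence_in_range:
  fixes v :: "nat \<Rightarrow> complex^'n"
  assumes rec: "\<forall>i\<in>{1..n}. \<beta> (i+1) i *s v (i+1) = K *v v i - (\<Sum>l=1..i. \<beta> l i *s v l)"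
    and nz: "\<forall>i\<in>{1..n}. \<beta> (i+1) i \<noteq> 0"
    and v1: "P *v v 1 = v 1"
    and PK: "P ** K = K"
    and "i \<in> {1..n+1}"
  shows "P *v v i = v i"
  using assms(5)
proof (induction i rule: less_induct)
  case (less i)
  show ?case
  proof (cases "i = 1")
    case True
    then show ?thesis
      using v1 by simp
  next
    case False
    then obtain j where j: "i = j + 1" "j \<in> {1..n}"
      using less.prems by (cases i) auto
    have "P *v (K *v v j) = K *v v j"
      by (simp add: matrix_vector_mul_assoc PK)
    moreover have "P *v (\<Sum>l=1..j. \<beta> l j *s v l) = (\<Sum>l=1..j. \<beta> l j *s v l)"
      using less.IH j by (subst vec.linear_sum[OF matrix_vector_mul_linear_gen]) (auto simp: vector_scalar_commute intro!: sum.cong)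
    ultimately have "P *v (\<beta> i j *s v i) = \<beta> i j *s v i"
      using rec j by (simp add: matrix_vector_mult_diff_distrib)
    then show ?thesis
      using nz j by (simp add: vector_scalar_commute vector_mul_lcancel)
  qed
qed

text \<open>Pairing \<open>K *v v j\<close> with \<open>w i\<close> extracts
  \<open>\<beta> i j\<close>; moving \<open>K\<close> across gives zero by the other recurrence.
  Adjointness is assumed only on the generated vectors, and the two sequences enter abstractly, so
  that their roles can later be exchanged.\<close>

lemma biorthogonal_recurrence_coeff_zero:
  fixes v w :: "nat \<Rightarrow> complex^'n"
  assumes v_rec: "\<forall>i\<in>{1..n}. \<beta> (i+1) i *s v (i+1) = K *v v i - (\<Sum>l=1..i. \<beta> l i *s v l)"
    and w_rec: "\<forall>i\<in>{1..n}. \<gamma> (i+1) i *s w (i+1) = L *v w i - (\<Sum>l=1..i. \<gamma> l i *s w l)"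
    and biorth: "\<forall>p\<in>{1..n+1}. \<forall>q\<in>{1..n+1}. cdot (w p) (v q) = (if p = q then 1 else 0)"
    and adj: "\<And>p q. p \<in> {1..n+1} \<Longrightarrow> q \<in> {1..n+1} \<Longrightarrow> cdot (w p) (K *v v q) = cdot (L *v w p) (v q)"
    and ij: "1 \<le> i" "i + 1 < j" "j \<le> n"
  shows "\<beta> i j = 0"
proof -
  have "K *v v j = \<beta> (j+1) j *s v (j+1) + (\<Sum>l=1..j. \<beta> l j *s v l)"
    using v_rec ij by auto
  then have "cdot (w i) (K *v v j) = (\<Sum>l=1..j. \<beta> l j * cdot (w i) (v l))"
    \<comment> \<open>The leading term drops because \<open>j + 1\<close> differs from
      \<open>i\<close>; as \<open>j\<close> may equal \<open>n\<close>, biorthogonality is needed up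
      to \<open>n + 1\<close>.\<close>
    using biorth ij by (simp add: cdot_add_right cdot_scale_right cdot_sum_right)
  also have "\<dots> = (\<Sum>l=1..j. if l = i then \<beta> l j else 0)"
    using biorth ij by (intro sum.cong) auto
  also have "\<dots> = \<beta> i j"
    using ij by simp
  finally have 1: "cdot (w i) (K *v v j) = \<beta> i j" .
  have "L *v w i = \<gamma> (i+1) i *s w (i+1) + (\<Sum>l=1..i. \<gamma> l i *s w l)"
    using w_rec ij by auto
  moreover have "cdot (v j) (w l) = 0" if "l \<in> {1..i+1}" for l
    using biorth that ij by (subst cdot_commute) auto
  ultimately have "cdot (v j) (L *v w i) = 0"
    by (simp add: cdot_add_right cdot_scale_right cdot_sum_right)
  then have "cdot (L *v w i) (v j) = 0"
    by (subst cdot_commute) simp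
  then show ?thesis
    using 1 adj[of i j] ij by simp
qed

lemma recurrence_three_term:
  fixes v :: "nat \<Rightarrow> complex^'n"
  assumes "x = y - (\<Sum>l=1..i. \<beta> l i *s v l)" and "1 \<le> i"
    and zero: "\<And>l. 1 \<le> l \<Longrightarrow> l + 1 < i \<Longrightarrow> \<beta> l i = 0"
  shows "x = y - \<beta> i i *s v i - (if i = 1 then 0 else \<beta> (i-1) i *s v (i-1))"
proof (cases "i = 1")
  case True
  then show ?thesis
    using assms by simp
next
  case False
  \<comment> \<open>Here \<open>i\<close> is at least 2, so \<open>i - 1\<close> is a genuine index
    of the sum and distinct from \<open>i\<close>.\<close>
  have "(\<Sum>l=1..i. \<beta> l i *s v l) = (\<Sum>l\<in>{i-1, i}. \<beta> l i *s v l)"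
  proof (rule sum.mono_neutral_right)
    show "{i-1, i} \<subseteq> {1..i}"
      using False \<open>1 \<le> i\<close> by auto
    show "\<forall>l\<in>{1..i} - {i-1, i}. \<beta> l i *s v l = 0"
      by (auto intro!: zero)
  qed simp
  then show ?thesis
    using assms False by simp
qed

theorem theorem3p2:
  fixes A :: "real^'n^'n"
    and r0 rt0 :: "complex^'n"
    and C Ct :: "complex^'k^'n"
    and Dc :: "complex^'k^'k"
    and \<eta> \<eta>t :: complex
    and B Bt :: "complex^'n^'n"
    and m :: nat
    and v vt :: "nat \<Rightarrow> complex^'n"
    and \<beta> \<beta>t :: "nat \<Rightarrow> nat \<Rightarrow> complex"
  assumes Dc_def: "Dc = ctranspose Ct ** C"
    and Dc_pos: "positive_diagonal Dc"
    and B_def: "B = (mat 1 - C ** matrix_inv Dc ** ctranspose Ct) ** map_matrix complex_of_real A"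
    and Bt_def: "Bt = (mat 1 - Ct ** matrix_inv Dc ** ctranspose C) ** ctranspose (map_matrix complex_of_real A)"
    and m_pos: "m \<ge> 1"
    and v_1: "v 1 = \<eta> *s ((mat 1 - C ** matrix_inv Dc ** ctranspose Ct) *v r0)"
    and vt_1: "vt 1 = \<eta>t *s ((mat 1 - Ct ** matrix_inv Dc ** ctranspose C) *v rt0)"
    and krylov_not_inv: "\<forall>i\<in>{1..<m}. \<not> invariant_subspace B (krylov i B (v 1))"
    and krylov_t_not_inv: "\<forall>i\<in>{1..<m}. \<not> invariant_subspace Bt (krylov i Bt (vt 1))"
    and no_breakdown: "\<forall>i\<in>{1..m}. cdot (vt i) (v i) \<noteq> 0"
    and v_rec: "\<forall>i\<in>{1..m-1}.
          \<beta> (i+1) i *s v (i+1) = B *v v i - (\<Sum>l=1..i. \<beta> l i *s v l)"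
    and vt_rec: "\<forall>i\<in>{1..m-1}.
          \<beta>t (i+1) i *s vt (i+1) = Bt *v vt i - (\<Sum>l=1..i. \<beta>t l i *s vt l)"
    and biorth: "\<forall>p\<in>{1..m}. \<forall>q\<in>{1..m}. cdot (vt p) (v q) = (if p = q then 1 else 0)"
    and v_norm: "\<forall>i\<in>{1..m}. norm (v i) = 1"
  shows "(\<forall>j\<in>{1..m-1}. \<forall>i\<in>{1..j+1}. j > i + 1 \<longrightarrow> \<beta> i j = 0 \<and> \<beta>t i j = 0)
    \<and> (\<forall>i\<in>{1..m-1}.
          \<beta> (i+1) i *s v (i+1)
            = B *v v i - \<beta> i i *s v i - (if i = 1 then 0 else \<beta> (i-1) i *s v (i-1)))
    \<and> (\<forall>i\<in>{1..m-1}.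
          \<beta>t (i+1) i *s vt (i+1)
            = Bt *v vt i - \<beta>t i i *s vt i - (if i = 1 then 0 else \<beta>t (i-1) i *s vt (i-1)))"
proof -
  define P where "P = mat 1 - C ** matrix_inv Dc ** ctranspose Ct"
  define Pt where "Pt = mat 1 - Ct ** matrix_inv Dc ** ctranspose C"
  define Ac where "Ac = map_matrix complex_of_real A"
  have B: "B = P ** Ac" and Bt: "Bt = Pt ** ctranspose Ac"
    by (simp_all add: B_def Bt_def P_def Pt_def Ac_def)
  \<comment> \<open>The adjoint reverses the triple product and fixes its self-adjoint middle
    factor, which exchanges \<open>C\<close> and \<open>Ct\<close>.\<close>
  have adjP: "ctranspose P = Pt"
    by (simp add: P_def Pt_def ctranspose_diff ctranspose_mult ctranspose_mat_1
        positive_diagonal_ctranspose_matrix_inv[OF Dc_pos] matrix_mul_assoc)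
  have PP: "P ** P = P"
    unfolding P_def using positive_diagonal_matrix_inv(1)[OF Dc_pos]
    by (intro oblique_projector_idem) (simp add: Dc_def)
  then have PtPt: "Pt ** Pt = Pt"
    by (metis adjP ctranspose_mult)
  have n: "m - 1 + 1 = m" "{1..m-1} = {1..<m}"
    using m_pos by auto
  have v_nz: "\<forall>i\<in>{1..m-1}. \<beta> (i+1) i \<noteq> 0"
    using recurrence_subdiagonal_nonzero[OF v_rec] krylov_not_inv n by blast
  have vt_nz: "\<forall>i\<in>{1..m-1}. \<beta>t (i+1) i \<noteq> 0"
    using recurrence_subdiagonal_nonzero[OF vt_rec] krylov_t_not_inv n by blast
  \<comment> \<open>The starting vector is a multiple of an image under \<open>P\<close>, and
    \<open>P\<close> is idempotent.\<close>
  have "P *v v 1 = v 1"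
    using v_1 PP by (simp add: P_def[symmetric] vector_scalar_commute matrix_vector_mul_assoc)
  then have v_fix: "P *v v i = v i" if "i \<in> {1..m}" for i
    using recurrence_in_range[OF v_rec v_nz, of P i] that n PP B by (simp add: matrix_mul_assoc)
  have "Pt *v vt 1 = vt 1"
    using vt_1 PtPt by (simp add: Pt_def[symmetric] vector_scalar_commute matrix_vector_mul_assoc)
  then have vt_fix: "Pt *v vt i = vt i" if "i \<in> {1..m}" for i
    using recurrence_in_range[OF vt_rec vt_nz, of Pt i] that n PtPt Bt by (simp add: matrix_mul_assoc)
  \<comment> \<open>\<open>P\<close> crosses the pairing as \<open>Pt\<close> and is absorbed by
    \<open>vt p\<close>; then \<open>Ac\<close> crosses; finally \<open>P\<close> is inserted before
    \<open>v q\<close>, which it fixes, and crosses back as the factor \<open>Pt\<close> of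
    \<open>Bt\<close>.\<close>
  have adj: "cdot (vt p) (B *v v q) = cdot (Bt *v vt p) (v q)" if "p \<in> {1..m}" "q \<in> {1..m}" for p q
  proof -
    have "cdot (vt p) (B *v v q) = cdot (Pt *v vt p) (Ac *v v q)"
      by (simp add: B matrix_vector_mul_assoc[symmetric] cdot_matrix_vector_mult[of _ P] adjP)
    also have "\<dots> = cdot (ctranspose Ac *v vt p) (P *v v q)"
      using that by (simp add: vt_fix v_fix cdot_matrix_vector_mult)
    also have "\<dots> = cdot (Bt *v vt p) (v q)"
      by (simp add: Bt matrix_vector_mul_assoc[symmetric] cdot_matrix_vector_mult[of _ P] adjP)
    finally show ?thesis .
  qed
  \<comment> \<open>Conjugate symmetry turns adjointness and biorthogonality into the hypotheses for
    the exchanged pair, from which the dual coefficients are treated.\<close>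
  have adj': "cdot (v q) (Bt *v vt p) = cdot (B *v v q) (vt p)" if "p \<in> {1..m}" "q \<in> {1..m}" for p q
    using adj[OF that] by (metis cdot_commute)
  have biorth': "\<forall>p\<in>{1..m}. \<forall>q\<in>{1..m}. cdot (v p) (vt q) = (if p = q then 1 else 0)"
  proof (intro ballI)
    fix p q assume "p \<in> {1..m}" "q \<in> {1..m}"
    then show "cdot (v p) (vt q) = (if p = q then 1 else 0)"
      using biorth by (subst cdot_commute) auto
  qed
  have z: "\<beta> i j = 0" if "1 \<le> i" "i + 1 < j" "j \<le> m - 1" for i j
    using biorthogonal_recurrence_coeff_zero[OF v_rec vt_rec, unfolded n(1), OF biorth adj that] .
  have zt: "\<beta>t i j = 0" if "1 \<le> i" "i + 1 < j" "j \<le> m - 1" for i j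
    using biorthogonal_recurrence_coeff_zero[OF vt_rec v_rec, unfolded n(1), OF biorth' adj' that] .
  show ?thesis
  proof (intro conjI ballI)
    fix i assume i: "i \<in> {1..m-1}"
    show "\<beta> (i+1) i *s v (i+1) = B *v v i - \<beta> i i *s v i - (if i = 1 then 0 else \<beta> (i-1) i *s v (i-1))"
      using i v_rec z by (intro recurrence_three_term) auto
    show "\<beta>t (i+1) i *s vt (i+1) = Bt *v vt i - \<beta>t i i *s vt i - (if i = 1 then 0 else \<beta>t (i-1) i *s vt (i-1))"
      using i vt_rec zt by (intro recurrence_three_term) auto
  qed (use z zt in auto)
qed

end
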